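(* Consider a discrete-time Markov decision process with finite state space $\mathcal S$, finite action sets $\mathcal U(x)$, one-step cost $c(x,u)$ and transition law $P(\cdot\mid x,u)$. Assume that under every deterministic stationary policy the controlled chain has a single recurrent class. Then for every integer $N\ge1$, $$\inf_{\tilde\pi\in\mathcal P(\mathcal S)}g_N(\tilde\pi)=g^{\mathrm{erg}},$$ where $g_N(\tilde\pi)$ is the optimal value of the $N$-step self-transport problem with endpoint law $\tilde\pi$ and $g^{\mathrm{erg}}$ is the optimal long-run average cost.
   Context: $\mathcal P(\mathcal S)$ is the set of probability distributions on $\mathcal S$. A deterministic stationary policy is a map $\mu$ with $\mu(x)\in\mathcal U(x)$ for all $x$. The optimal long-run average cost is $$g^{\mathrm{erg}}=\inf_\mu\ \limsup_{N\to\infty}\frac1N\sum_{n=0}^{N-1}\mathbb E[c(X_n,\mu(X_n))],$$ the infimum over deterministic stationary policies, where $X_0\sim\pi_0$ and $X_{n+1}$ has conditional law $P(\cdot\mid X_n,\mu(X_n))$. (Under the single-recurrent-class assumption $g^{\mathrm{erg}}$ does not depend on the initial law $\pi_0$.) The $N$-step self-transport problem with endpoint law $\tilde\pi\in\mathcal P(\mathcal S)$ is to minimize $$\frac1N\sum_{n=0}^{N-1}\sum_{x\in\mathcal S}\sum_{u\in\mathcal U(x)}c(x,u)\,m_n(x,u)$$ over $\{m_n\}_{n=0}^{N-1}$ and $\{\pi_n\}_{n=0}^N\subset\mathcal P(\mathcal S)$ subject, for $n=0,\dots,N-1$, to: $m_n(x,u)\ge0$; $\sum_{u\in\mathcal U(x)}m_n(x,u)=\pi_n(x)$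 for all $x$; $\pi_{n+1}(y)=\sum_{x\in\mathcal S}\sum_{u\in\mathcal U(x)}m_n(x,u)P(y\mid x,u)$ for all $y$; and the endpoint condition $\pi_0=\pi_N=\tilde\pi$. Its optimal value is $g_N(\tilde\pi)$, with the convention $+\infty$ if infeasible. *)

theory Defs
  imports "HOL-Probability.Probability"
begin

text \<open>Law of the history \<open>[X\<^sub>0, \<dots>, X\<^sub>n]\<close> of the Markov chain with initial law
  \<open>\<pi>0\<close> and transition kernel \<open>K\<close>.\<close>

primrec path_law :: "('s \<Rightarrow> 's pmf) \<Rightarrow> 's pmf \<Rightarrow> nat \<Rightarrow> 's list pmf" where
  "path_law K \<pi>0 0 = map_pmf (\<lambda>x. [x]) \<pi>0"
| "path_law K \<pi>0 (Suc n) =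
     bind_pmf (path_law K \<pi>0 n) (\<lambda>xs. map_pmf (\<lambda>y. xs @ [y]) (K (last xs)))"

definition accessible :: "('s \<Rightarrow> 's pmf) \<Rightarrow> 's \<Rightarrow> 's \<Rightarrow> bool" where
  "accessible K x y \<longleftrightarrow> (x, y) \<in> {(a, b). pmf (K a) b > 0}\<^sup>*"

text \<open>A state is recurrent if the chain started there returns to it almost surely. The
  probability of returning within \<open>n\<close> steps increases to the probability of ever returning,
  so histories of finite length suffice; \<open>tl\<close> discards the time-zero state.\<close>

definition recurrent_state :: "('s \<Rightarrow> 's pmf) \<Rightarrow> 's \<Rightarrow> bool" where
  "recurrent_state K x \<longleftrightarrow>
     (\<lambda>n. measure_pmf.prob (path_law K (return_pmf x) n) {xs. x \<in> set (tl xs)}) \<longlonglongrightarrow> 1"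

definition communicating_class :: "('s \<Rightarrow> 's pmf) \<Rightarrow> 's \<Rightarrow> 's set" where
  "communicating_class K x = {y. accessible K x y \<and> accessible K y x}"

definition recurrent_classes :: "('s \<Rightarrow> 's pmf) \<Rightarrow> 's set set" where
  "recurrent_classes K = communicating_class K ` {x. recurrent_state K x}"

definition policies :: "('s \<Rightarrow> 'u set) \<Rightarrow> ('s \<Rightarrow> 'u) set" where
  "policies U = {\<mu>. \<forall>x. \<mu> x \<in> U x}"

definition closed_loop :: "('s \<Rightarrow> 'u \<Rightarrow> 's pmf) \<Rightarrow> ('s \<Rightarrow> 'u) \<Rightarrow> 's \<Rightarrow> 's pmf" where
  "closed_loop P \<mu> = (\<lambda>x. P x (\<mu> x))"

text \<open>\<open>\<bbbE>[c(X\<^sub>n, \<mu>(X\<^sub>n))]\<close>; the entry \<open>xs ! n\<close> of the history up to time \<open>n\<close> is \<open>X\<^sub>n\<close>.\<close>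

definition expected_cost ::
  "('s \<Rightarrow> 'u \<Rightarrow> 's pmf) \<Rightarrow> ('s \<Rightarrow> 'u \<Rightarrow> real) \<Rightarrow> 's pmf \<Rightarrow> ('s \<Rightarrow> 'u) \<Rightarrow> nat \<Rightarrow> real" where
  "expected_cost P c \<pi>0 \<mu> n =
     measure_pmf.expectation (path_law (closed_loop P \<mu>) \<pi>0 n)
       (\<lambda>xs. c (xs ! n) (\<mu> (xs ! n)))"

definition g_erg ::
  "('s \<Rightarrow> 'u set) \<Rightarrow> ('s \<Rightarrow> 'u \<Rightarrow> 's pmf) \<Rightarrow> ('s \<Rightarrow> 'u \<Rightarrow> real) \<Rightarrow> 's pmf \<Rightarrow> ereal" where
  "g_erg U P c \<pi>0 =
     (INF \<mu>\<in>policies U.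
        limsup (\<lambda>N. ereal (1 / real N * (\<Sum>n<N. expected_cost P c \<pi>0 \<mu> n))))"

text \<open>Only \<open>m n\<close> for \<open>n < N\<close> (on admissible pairs) and \<open>\<pi> n\<close> for \<open>n \<le> N\<close> are decision
  variables; the remaining values are unconstrained and do not enter the cost.\<close>

definition self_transport_feasible ::
  "('s::finite \<Rightarrow> 'u set) \<Rightarrow> ('s \<Rightarrow> 'u \<Rightarrow> 's pmf) \<Rightarrow> nat \<Rightarrow> 's pmf \<Rightarrow>
   (nat \<Rightarrow> 's \<Rightarrow> 'u \<Rightarrow> real) \<Rightarrow> (nat \<Rightarrow> 's pmf) \<Rightarrow> bool" where
  "self_transport_feasible U P N \<rho> m \<pi> \<longleftrightarrow>
     (\<forall>n<N. (\<forall>x. \<forall>u\<in>U x. 0 \<le> m n x u) \<and>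
            (\<forall>x. (\<Sum>u\<in>U x. m n x u) = pmf (\<pi> n) x) \<and>
            (\<forall>y. pmf (\<pi> (Suc n)) y = (\<Sum>x\<in>UNIV. \<Sum>u\<in>U x. m n x u * pmf (P x u) y))) \<and>
     \<pi> 0 = \<rho> \<and> \<pi> N = \<rho>"

definition self_transport_cost ::
  "('s::finite \<Rightarrow> 'u set) \<Rightarrow> ('s \<Rightarrow> 'u \<Rightarrow> real) \<Rightarrow> nat \<Rightarrow> (nat \<Rightarrow> 's \<Rightarrow> 'u \<Rightarrow> real) \<Rightarrow> real" where
  "self_transport_cost U c N m =
     1 / real N * (\<Sum>n<N. \<Sum>x\<in>UNIV. \<Sum>u\<in>U x. c x u * m n x u)"

text \<open>The infimum over an empty feasible set is \<open>\<infinity>\<close> in \<^typ>\<open>ereal\<close>.\<close>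

definition g_self_transport ::
  "('s::finite \<Rightarrow> 'u set) \<Rightarrow> ('s \<Rightarrow> 'u \<Rightarrow> 's pmf) \<Rightarrow> ('s \<Rightarrow> 'u \<Rightarrow> real) \<Rightarrow> nat \<Rightarrow> 's pmf \<Rightarrow> ereal"
where
  "g_self_transport U P c N \<rho> =
     (INF (m, \<pi>)\<in>{(m, \<pi>). self_transport_feasible U P N \<rho> m \<pi>}.
        ereal (self_transport_cost U c N m))"

end

theory Submission
  imports Defs
begin

text \<open>Both sides equal the least cost of a stationary occupation measure, that is, of a probability
  weight on the admissible state-action pairs whose state marginal is preserved by one transition.

  A periodic flow yields such a measure with the same cost: averaging the \<open>m\<^sub>n\<close> over one period
  telescopes because the two endpoint laws agree (\<open>self_transport_average\<close>). Conversely, a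
  stationary law of a policy, repeated at every time, is a self-transport plan. Hence the value on
  the left does not depend on the number of steps.

  The upper bound on the left-hand side comes from compactness: every limit point of the
  time-averaged laws of a finite chain is stationary, and choosing times along which the average
  cost approaches its upper limit gives a stationary law whose cost is exactly that upper limit
  (\<open>limsup_average_stationary\<close>).

  For the lower bound a randomised occupation measure has to be replaced by a deterministic policy.
  This is the vertex argument of linear programming, made explicit by induction on the size of the
  support (\<open>policy_no_worse_than_occupation\<close>). A policy \<open>\<mu>\<close> that picks, in each occupied state, some
  action charged by \<open>m\<close> keeps the chain inside the occupied states, so it has an occupation measure
  supported within that of \<open>m\<close>. Either this measure is \<open>m\<close> itself, or moving from \<open>m\<close> along the line
  through both, in the direction of nonincreasing cost and until a coordinate vanishes, leads to a
  smaller support.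

  The policy found in this way meets the cost bound at one of its stationary laws, whereas the
  long-run average from \<open>\<pi>0\<close> is the cost of a possibly different one. The single recurrent class
  excludes a second stationary law (\<open>stationary_unique\<close>): the sets where the difference of two
  invariant laws is positive and negative are both closed, and each would contain a recurrent state.\<close>

section \<open>Marginal laws and limits of their averages\<close>

lemma pmf_bind_finite:
  fixes \<pi> :: "'s::finite pmf"
  shows "pmf (bind_pmf \<pi> K) y = (\<Sum>x\<in>UNIV. pmf \<pi> x * pmf (K x) y)"
  by (simp add: pmf_bind integral_measure_pmf_real[of UNIV] mult.commute)

lemma length_path_law: "xs \<in> set_pmf (path_law K \<pi>0 n) \<Longrightarrow> length xs = Suc n"
  by (induction n arbitrary: xs) auto

lemma last_path_law_Suc:
  "map_pmf last (path_law K \<pi>0 (Suc n)) = bind_pmf (map_pmf last (path_law K \<pi>0 n)) K"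
  by (simp add: map_bind_pmf bind_map_pmf pmf.map_comp o_def)

lemma expected_cost_marginal:
  fixes P :: "'s::finite \<Rightarrow> 'u \<Rightarrow> 's pmf"
  shows "expected_cost P c \<pi>0 \<mu> n =
    (\<Sum>x\<in>UNIV. pmf (map_pmf last (path_law (closed_loop P \<mu>) \<pi>0 n)) x * c x (\<mu> x))"
proof -
  let ?L = "path_law (closed_loop P \<mu>) \<pi>0 n"
  have last: "xs ! n = last xs" if "xs \<in> set_pmf ?L" for xs
  proof -
    have "length xs = Suc n" using length_path_law[OF that] .
    then show ?thesis by (cases xs) (auto simp: last_conv_nth)
  qed
  have "expected_cost P c \<pi>0 \<mu> n =
      measure_pmf.expectation ?L (\<lambda>xs. c (last xs) (\<mu> (last xs)))"
    unfolding expected_cost_def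
    by (rule integral_cong_AE) (auto simp: AE_measure_pmf_iff last)
  also have "\<dots> = measure_pmf.expectation (map_pmf last ?L) (\<lambda>x. c x (\<mu> x))"
    by simp
  also have "\<dots> = (\<Sum>x\<in>UNIV. pmf (map_pmf last ?L) x * c x (\<mu> x))"
    by (subst integral_measure_pmf_real[of UNIV]) (auto simp: mult.commute)
  finally show ?thesis .
qed

lemma set_last_path_law_subset:
  assumes "\<And>x. x \<in> A \<Longrightarrow> set_pmf (K x) \<subseteq> A" and "set_pmf \<pi>0 \<subseteq> A"
  shows "set_pmf (map_pmf last (path_law K \<pi>0 n)) \<subseteq> A"
proof (induction n)
  case 0
  then show ?case using assms(2) by (simp add: image_image)
next
  case (Suc n)
  then show ?case using assms(1) unfolding last_path_law_Suc by (auto simp: subset_iff)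
qed

lemma pmf_of_weights:
  fixes q :: "'s::finite \<Rightarrow> real"
  assumes "\<And>x. q x \<ge> 0" and "(\<Sum>x\<in>UNIV. q x) = 1"
  obtains \<pi> where "\<And>x. pmf \<pi> x = q x"
proof -
  have "(\<integral>\<^sup>+ x. ennreal (q x) \<partial>count_space UNIV) = 1"
    using assms by (simp add: nn_integral_count_space_finite)
  then have "pmf (embed_pmf q) x = q x" for x
    using assms(1) by (intro pmf_embed_pmf) auto
  then show thesis using that by blast
qed

text \<open>Averaging \<open>N\<close> successive laws gives a law that one transition changes by at most \<open>1/N\<close> in each
  state, so every limit point is stationary. The limit point is taken along a subsequence that
  realises the upper limit of the costs, which makes its cost equal to that limit.
  Confinement to a closed set \<open>A\<close> passes to the limit; it is what keeps supports under control when
  occupation measures are compared.\<close>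
lemma limsup_average_stationary:
  fixes K :: "'s::finite \<Rightarrow> 's pmf" and f :: "'s \<Rightarrow> real"
  assumes closed: "\<And>x. x \<in> A \<Longrightarrow> set_pmf (K x) \<subseteq> A" and init: "set_pmf \<pi>0 \<subseteq> A"
  obtains \<pi> where "bind_pmf \<pi> K = \<pi>" and "set_pmf \<pi> \<subseteq> A"
    and "limsup (\<lambda>N. ereal (1 / real N *
           (\<Sum>n<N. \<Sum>x\<in>UNIV. pmf (map_pmf last (path_law K \<pi>0 n)) x * f x))) =
         ereal (\<Sum>x\<in>UNIV. pmf \<pi> x * f x)"
proof -
  define p where "p n = pmf (map_pmf last (path_law K \<pi>0 n))" for n
  define a where "a N x = 1 / real N * (\<Sum>n<N. p n x)" for N x
  define avg where "avg N = ereal (1 / real N * (\<Sum>n<N. \<Sum>x\<in>UNIV. p n x * f x))" for N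
  have p_nonneg: "p n x \<ge> 0" and p_le: "p n x \<le> 1" for n x
    by (auto simp: p_def pmf_le_1)
  have p_sum: "(\<Sum>x\<in>UNIV. p n x) = 1" for n
    unfolding p_def by (rule sum_pmf_eq_1) auto
  have p_Suc: "p (Suc n) y = (\<Sum>x\<in>UNIV. p n x * pmf (K x) y)" for n y
    unfolding p_def last_path_law_Suc by (rule pmf_bind_finite)
  have p_out: "p n x = 0" if "x \<notin> A" for n x
    using set_last_path_law_subset[of A K \<pi>0 n, OF closed init] that
    by (auto simp: p_def set_pmf_iff simp del: set_map_pmf)
  have avg_a: "avg N = ereal (\<Sum>x\<in>UNIV. a N x * f x)" for N
    unfolding avg_def a_def
    by (subst sum.swap) (simp add: sum_distrib_left sum_distrib_right mult.assoc)
  have a_nonneg: "a N x \<ge> 0" for N x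
    by (simp add: a_def p_nonneg sum_nonneg)
  have a_le: "a N x \<le> 1" for N x
  proof -
    have "(\<Sum>n<N. p n x) \<le> (\<Sum>n<N. 1)" by (rule sum_mono) (rule p_le)
    then show ?thesis by (cases "N = 0") (auto simp: a_def field_simps)
  qed
  have a_sum: "(\<Sum>x\<in>UNIV. a N x) = 1" if "N > 0" for N
  proof -
    have "(\<Sum>x\<in>UNIV. a N x) = 1 / real N * (\<Sum>n<N. \<Sum>x\<in>UNIV. p n x)"
      unfolding a_def by (subst sum.swap) (simp add: sum_distrib_left)
    then show ?thesis using that by (simp add: p_sum)
  qed
  have a_step: "(\<Sum>x\<in>UNIV. a N x * pmf (K x) y) - a N y = (p N y - p 0 y) / real N" for N y
  proof -
    have "(\<Sum>x\<in>UNIV. a N x * pmf (K x) y) = 1 / real N * (\<Sum>n<N. p (Suc n) y)"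
      unfolding a_def p_Suc
      by (subst sum.swap) (simp add: sum_distrib_left sum_distrib_right mult.assoc)
    moreover have "(\<Sum>n<N. p (Suc n) y) - (\<Sum>n<N. p n y) = p N y - p 0 y"
      using sum_lessThan_telescope[of "\<lambda>n. p n y" N] by (simp add: sum_subtractf)
    ultimately show ?thesis
      by (simp add: a_def diff_divide_distrib[symmetric])
  qed
  \<comment> \<open>Two extractions: \<open>r\<close> realises the upper limit of the cost, \<open>s\<close> makes the averaged laws converge.\<close>
  obtain r :: "nat \<Rightarrow> nat" where r: "strict_mono r" "(avg \<circ> r) \<longlonglongrightarrow> limsup avg"
    using limsup_subseq_lim by blast
  have "bounded (range (\<lambda>k. (\<chi> x. a (r k) x) :: real ^ 's))"
  proof (rule boundedI)
    fix v :: "real ^ 's" assume "v \<in> range (\<lambda>k. (\<chi> x. a (r k) x))"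
    then obtain k where v: "v = (\<chi> x. a (r k) x)" by auto
    have "norm v \<le> (\<Sum>x\<in>UNIV. \<bar>v $ x\<bar>)" by (rule norm_le_l1_cart)
    also have "\<dots> \<le> (\<Sum>x\<in>(UNIV :: 's set). 1)"
      by (rule sum_mono) (simp add: v a_nonneg a_le)
    finally show "norm v \<le> real CARD('s)" by simp
  qed
  then obtain l :: "real ^ 's" and s :: "nat \<Rightarrow> nat" where s: "strict_mono s"
    and l: "((\<lambda>k. (\<chi> x. a (r k) x)) \<circ> s) \<longlonglongrightarrow> l"
    using bounded_imp_convergent_subsequence by blast
  define t where "t = r \<circ> s"
  have t: "strict_mono t" unfolding t_def using r(1) s by (rule strict_mono_o)
  have lim: "(\<lambda>k. a (t k) x) \<longlonglongrightarrow> l $ x" for x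
    using tendsto_vec_nth[OF l, of x] by (simp add: t_def o_def)
  have nonneg: "l $ x \<ge> 0" for x
    by (rule LIMSEQ_le_const[OF lim]) (simp add: a_nonneg)
  have t_pos: "t k > 0" if "k > 0" for k
    using seq_suble[OF t, of k] that by linarith
  have total: "(\<Sum>x\<in>UNIV. l $ x) = 1"
  proof (rule LIMSEQ_unique)
    show "(\<lambda>k. \<Sum>x\<in>UNIV. a (t k) x) \<longlonglongrightarrow> (\<Sum>x\<in>UNIV. l $ x)"
      by (intro tendsto_sum lim)
    have "eventually (\<lambda>k. (\<Sum>x\<in>UNIV. a (t k) x) = 1) sequentially"
      using eventually_gt_at_top[of 0] by eventually_elim (simp add: a_sum t_pos)
    then show "(\<lambda>k. \<Sum>x\<in>UNIV. a (t k) x) \<longlonglongrightarrow> 1"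
      by (rule tendsto_eventually)
  qed
  obtain \<pi> where \<pi>: "\<And>x. pmf \<pi> x = l $ x"
    using pmf_of_weights[of "\<lambda>x. l $ x"] nonneg total by blast
  have balance: "(\<Sum>x\<in>UNIV. l $ x * pmf (K x) y) = l $ y" for y
  proof -
    have "(\<lambda>k. (\<Sum>x\<in>UNIV. a (t k) x * pmf (K x) y) - a (t k) y)
        \<longlonglongrightarrow> (\<Sum>x\<in>UNIV. l $ x * pmf (K x) y) - l $ y"
      by (intro tendsto_intros lim)
    moreover have "(\<lambda>k. (\<Sum>x\<in>UNIV. a (t k) x * pmf (K x) y) - a (t k) y) \<longlonglongrightarrow> 0"
    proof -
      have "(\<lambda>N. (p N y - p 0 y) / real N) \<longlonglongrightarrow> 0"
      proof (rule Lim_null_comparison)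
        have "\<bar>p N y - p 0 y\<bar> \<le> 1" for N
          using p_nonneg[of N y] p_nonneg[of 0 y] p_le[of N y] p_le[of 0 y] by linarith
        then show "\<forall>\<^sub>F N in sequentially. norm ((p N y - p 0 y) / real N) \<le> 1 / real N"
          by (intro always_eventually) (simp add: divide_right_mono)
        show "(\<lambda>N. 1 / real N) \<longlonglongrightarrow> 0" by (rule lim_1_over_n)
      qed
      then show ?thesis
        unfolding a_step using LIMSEQ_subseq_LIMSEQ[OF _ t] by (fastforce simp: o_def)
    qed
    ultimately show ?thesis using LIMSEQ_unique by fastforce
  qed
  show thesis
  proof
    show "bind_pmf \<pi> K = \<pi>"
      by (rule pmf_eqI) (simp add: pmf_bind_finite \<pi> balance)
    show "set_pmf \<pi> \<subseteq> A"
    proof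
      fix x assume "x \<in> set_pmf \<pi>"
      then have "l $ x \<noteq> 0" using \<pi> by (simp add: set_pmf_iff)
      moreover have "l $ x = 0" if "x \<notin> A"
        using lim[of x] that by (simp add: a_def p_out LIMSEQ_const_iff)
      ultimately show "x \<in> A" by blast
    qed
    have "(avg \<circ> t) \<longlonglongrightarrow> limsup avg"
      unfolding t_def o_assoc using LIMSEQ_subseq_LIMSEQ[OF r(2) s] .
    moreover have "(avg \<circ> t) \<longlonglongrightarrow> ereal (\<Sum>x\<in>UNIV. pmf \<pi> x * f x)"
      unfolding avg_a o_def \<pi> by (intro tendsto_intros lim)
    ultimately have "limsup avg = ereal (\<Sum>x\<in>UNIV. pmf \<pi> x * f x)"
      by (rule LIMSEQ_unique)
    then show "limsup (\<lambda>N. ereal (1 / real N *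
           (\<Sum>n<N. \<Sum>x\<in>UNIV. pmf (map_pmf last (path_law K \<pi>0 n)) x * f x))) =
         ereal (\<Sum>x\<in>UNIV. pmf \<pi> x * f x)"
      unfolding avg_def p_def .
  qed
qed

section \<open>Recurrent states\<close>

text \<open>Histories are built by appending states, whereas hitting probabilities are governed by the first
  transition; this turns one description into the other.\<close>
lemma path_law_first_step:
  "path_law K (return_pmf y) (Suc n) =
     bind_pmf (K y) (\<lambda>z. map_pmf ((#) y) (path_law K (return_pmf z) n))"
proof (induction n)
  case 0
  then show ?case by (simp add: bind_return_pmf map_pmf_def bind_assoc_pmf)
next
  case (Suc n)
  have nonempty: "xs \<noteq> []" if "xs \<in> set_pmf (path_law K (return_pmf z) n)" for xs z
    using length_path_law[OF that] by auto
  have "path_law K (return_pmf y) (Suc (Suc n)) =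
      bind_pmf (K y) (\<lambda>z. bind_pmf (path_law K (return_pmf z) n)
        (\<lambda>xs. map_pmf (\<lambda>w. (y # xs) @ [w]) (K (last (y # xs)))))"
    by (subst path_law.simps(2), subst Suc) (simp add: bind_assoc_pmf bind_map_pmf)
  also have "\<dots> = bind_pmf (K y) (\<lambda>z. bind_pmf (path_law K (return_pmf z) n)
        (\<lambda>xs. map_pmf ((#) y) (map_pmf (\<lambda>w. xs @ [w]) (K (last xs)))))"
    by (intro bind_pmf_cong refl) (simp add: nonempty pmf.map_comp o_def)
  also have "\<dots> = bind_pmf (K y) (\<lambda>z. map_pmf ((#) y) (path_law K (return_pmf z) (Suc n)))"
    by (simp add: map_bind_pmf)
  finally show ?case .
qed

definition avoid_prob :: "('s \<Rightarrow> 's pmf) \<Rightarrow> 's \<Rightarrow> nat \<Rightarrow> 's \<Rightarrow> real" where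
  "avoid_prob K x n y =
     measure_pmf.prob (path_law K (return_pmf y) n) {xs. x \<notin> set (tl xs)}"

lemma avoid_prob_0: "avoid_prob K x 0 y = 1"
  by (simp add: avoid_prob_def)

lemma avoid_prob_Suc:
  fixes K :: "'s::finite \<Rightarrow> 's pmf"
  shows "avoid_prob K x (Suc n) y =
    (\<Sum>z\<in>UNIV. pmf (K y) z * (if z = x then 0 else avoid_prob K x n z))"
proof -
  have as_pmf: "measure_pmf.prob M {xs. Q xs} = pmf (map_pmf Q M) True"
    for M :: "'s list pmf" and Q
    by (simp add: pmf_map vimage_def)
  have start: "set xs = insert z (set (tl xs))"
    if "xs \<in> set_pmf (path_law K (return_pmf z) n)" for xs z
  proof -
    have "xs \<noteq> [] \<and> hd xs = z" using that
      by (induction n arbitrary: xs) auto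
    then show ?thesis by (cases xs) auto
  qed
  have "avoid_prob K x (Suc n) y =
      (\<Sum>z\<in>UNIV. pmf (K y) z *
        pmf (map_pmf (\<lambda>xs. x \<notin> set xs) (path_law K (return_pmf z) n)) True)"
    unfolding avoid_prob_def as_pmf path_law_first_step map_bind_pmf
    by (simp add: pmf_bind_finite pmf.map_comp o_def)
  also have "\<dots> = (\<Sum>z\<in>UNIV. pmf (K y) z * (if z = x then 0 else avoid_prob K x n z))"
  proof (intro sum.cong refl arg_cong2[where f = "(*)"])
    fix z
    have "map_pmf (\<lambda>xs. x \<notin> set xs) (path_law K (return_pmf z) n) =
        map_pmf (\<lambda>xs. z \<noteq> x \<and> x \<notin> set (tl xs)) (path_law K (return_pmf z) n)"
      by (intro map_pmf_cong refl) (auto simp: start)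
    then show "pmf (map_pmf (\<lambda>xs. x \<notin> set xs) (path_law K (return_pmf z) n)) True =
        (if z = x then 0 else avoid_prob K x n z)"
      by (simp add: avoid_prob_def as_pmf)
  qed
  finally show ?thesis .
qed

lemma accessible_trans: "accessible K x y \<Longrightarrow> accessible K y z \<Longrightarrow> accessible K x z"
  unfolding accessible_def by (rule rtrancl_trans)

lemma accessible_step: "z \<in> set_pmf (K y) \<Longrightarrow> accessible K y z"
  unfolding accessible_def by (auto simp: set_pmf_iff less_le intro!: r_into_rtrancl)

lemma accessible_closed:
  assumes "accessible K x y" and "x \<in> A" and "\<And>z. z \<in> A \<Longrightarrow> set_pmf (K z) \<subseteq> A"
  shows "y \<in> A"
  using assms(1) unfolding accessible_def
proof (induction rule: rtrancl_induct)
  case base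
  then show ?case by (rule assms(2))
next
  case (step y z)
  then show ?case using assms(3)[of y] by (auto simp: set_pmf_iff subset_iff)
qed

text \<open>A maximum principle. The limit \<open>L\<close> of the avoidance probabilities satisfies
  \<open>L y = (\<Sum>z\<noteq>x. K y z * L z)\<close>. If its maximum \<open>M\<close> over the states accessible from \<open>x\<close> were positive,
  then every successor of a maximiser would be a maximiser different from \<open>x\<close>, so that \<open>x\<close> could not
  be reached from there.\<close>
lemma recurrent_if_always_accessible:
  fixes K :: "'s::finite \<Rightarrow> 's pmf"
  assumes ret: "\<And>y. accessible K x y \<Longrightarrow> accessible K y x"
  shows "recurrent_state K x"
proof -
  let ?q = "avoid_prob K x"
  define C where "C = {y. accessible K x y}"
  have xC: "x \<in> C" by (simp add: C_def accessible_def)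
  have closed: "set_pmf (K y) \<subseteq> C" if "y \<in> C" for y
    using that accessible_trans accessible_step by (fastforce simp: C_def)
  have nonneg: "?q n y \<ge> 0" for n y by (simp add: avoid_prob_def)
  have dec: "?q (Suc n) y \<le> ?q n y" for n y
  proof (induction n arbitrary: y)
    case 0
    then show ?case by (simp add: avoid_prob_0) (simp add: avoid_prob_def)
  next
    case (Suc n)
    then show ?case
      unfolding avoid_prob_Suc[of K x "Suc n"] avoid_prob_Suc[of K x n y]
      by (intro sum_mono mult_left_mono) auto
  qed
  have "\<exists>l. (\<lambda>n. ?q n y) \<longlonglongrightarrow> l" for y
    using decseq_convergent[of "\<lambda>n. ?q n y" 0] decseq_SucI[of "\<lambda>n. ?q n y"] dec nonneg
    by metis
  then obtain L where lim: "\<And>y. (\<lambda>n. ?q n y) \<longlonglongrightarrow> L y" by metis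
  define g where "g z = (if z = x then 0 else L z)" for z
  have L_eq: "L y = (\<Sum>z\<in>UNIV. pmf (K y) z * g z)" for y
  proof (rule LIMSEQ_unique)
    show "(\<lambda>n. ?q (Suc n) y) \<longlonglongrightarrow> L y" by (rule LIMSEQ_Suc[OF lim])
    show "(\<lambda>n. ?q (Suc n) y) \<longlonglongrightarrow> (\<Sum>z\<in>UNIV. pmf (K y) z * g z)"
      unfolding avoid_prob_Suc g_def
      by (intro tendsto_sum tendsto_mult tendsto_const) (auto intro: lim)
  qed
  have L_nonneg: "L y \<ge> 0" for y
    by (rule LIMSEQ_le_const[OF lim]) (simp add: nonneg)
  define M where "M = Max (L ` C)"
  have L_le: "L y \<le> M" if "y \<in> C" for y
    unfolding M_def using that by (intro Max_ge) auto
  have "M \<in> L ` C" unfolding M_def using xC by (intro Max_in) auto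
  then obtain y where y: "y \<in> C" "L y = M" by auto
  have "M \<le> 0"
  proof (rule ccontr)
    assume "\<not> M \<le> 0"
    then have M: "M > 0" by simp
    define Z where "Z = {y \<in> C. L y = M}"
    have succ: "z \<in> Z \<and> z \<noteq> x" if "y \<in> Z" "z \<in> set_pmf (K y)" for y z
    proof -
      have "y \<in> C" "L y = M" using that(1) by (auto simp: Z_def)
      have term_nonneg: "pmf (K y) w * (M - g w) \<ge> 0" for w
      proof (cases "w \<in> set_pmf (K y)")
        case True
        then have "g w \<le> M" using closed[OF \<open>y \<in> C\<close>] L_le M by (auto simp: g_def)
        then show ?thesis by simp
      next
        case False
        then show ?thesis by (simp add: set_pmf_iff)
      qed
      have "(\<Sum>w\<in>UNIV. pmf (K y) w * (M - g w)) =
          M * (\<Sum>w\<in>UNIV. pmf (K y) w) - (\<Sum>w\<in>UNIV. pmf (K y) w * g w)"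
        by (simp add: algebra_simps sum_subtractf sum_distrib_left)
      also have "\<dots> = 0"
        using L_eq[of y] \<open>L y = M\<close> sum_pmf_eq_1[of UNIV "K y"] by simp
      finally have "pmf (K y) z * (M - g z) = 0"
        using term_nonneg by (simp add: sum_nonneg_eq_0_iff)
      then have "g z = M" using that(2) by (simp add: set_pmf_iff)
      then show ?thesis
        using M that(2) closed[OF \<open>y \<in> C\<close>] by (auto simp: g_def Z_def split: if_splits)
    qed
    (* The maximiser y may be x itself, which reaches x by the empty path; a successor z of y
       is different from x and therefore needs a path with a genuine last step into x. *)
    obtain z where "z \<in> set_pmf (K y)" using set_pmf_not_empty by fast
    then have z: "z \<in> Z" "z \<noteq> x" using succ[of y z] y by (auto simp: Z_def)
    have "accessible K z x" using z ret by (auto simp: Z_def C_def)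
    then obtain w where w: "accessible K z w" "pmf (K w) x > 0"
      using z(2) unfolding accessible_def by (auto elim: rtranclE)
    have "w \<in> Z" using accessible_closed[OF w(1) z(1)] succ by blast
    then show False using succ[of w x] w(2) by (auto simp: set_pmf_iff)
  qed
  then have "L x = 0" using L_le[OF xC] L_nonneg[of x] by linarith
  then have "(\<lambda>n. 1 - ?q n x) \<longlonglongrightarrow> 1 - 0" using lim[of x] by (intro tendsto_intros) simp
  moreover have "measure_pmf.prob (path_law K (return_pmf x) n) {xs. x \<in> set (tl xs)} =
      1 - ?q n x" for n
  proof -
    have "measure_pmf.prob (path_law K (return_pmf x) n) (UNIV - {xs. x \<notin> set (tl xs)}) =
        1 - ?q n x"
      unfolding avoid_prob_def by (subst measure_pmf.prob_compl[symmetric]) auto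
    moreover have "UNIV - {xs. x \<notin> set (tl xs)} = {xs. x \<in> set (tl xs)}" by auto
    ultimately show ?thesis by simp
  qed
  ultimately show ?thesis unfolding recurrent_state_def by simp
qed

text \<open>A state of \<open>A\<close> with the fewest accessible states is accessible from all of them, since a state that
  it reaches can only reach some of them, and minimality makes it reach all.\<close>
lemma closed_set_has_recurrent_state:
  fixes K :: "'s::finite \<Rightarrow> 's pmf"
  assumes "A \<noteq> {}" and closed: "\<And>x. x \<in> A \<Longrightarrow> set_pmf (K x) \<subseteq> A"
  obtains x where "x \<in> A" and "recurrent_state K x"
proof -
  let ?R = "\<lambda>x. {y. accessible K x y}"
  obtain a where "a \<in> A" using assms(1) by blast
  then have "\<exists>x. x \<in> A \<and> (\<forall>y. y \<in> A \<longrightarrow> card (?R x) \<le> card (?R y))"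
    by (rule ex_has_least_nat)
  then obtain x where x: "x \<in> A" "\<And>y. y \<in> A \<Longrightarrow> card (?R x) \<le> card (?R y)"
    by blast
  have "accessible K y x" if "accessible K x y" for y
  proof -
    have "y \<in> A" using accessible_closed[OF that x(1) closed] .
    moreover have "?R y \<subseteq> ?R x" using accessible_trans[OF that] by auto
    ultimately have "?R y = ?R x" using x(2) by (intro card_seteq) auto
    then show ?thesis by (auto simp: accessible_def)
  qed
  then show thesis using that[OF x(1)] recurrent_if_always_accessible by blast
qed

section \<open>Uniqueness of the stationary law\<close>

text \<open>Let \<open>A\<close> be the set where \<open>d\<close> is positive. The mass of \<open>d\<close> on \<open>A\<close> is what one transition sends
  there. States outside \<open>A\<close> contribute nothing positive, so the states of \<open>A\<close> would lose mass on
  balance if one of them had a positive probability of leaving.\<close>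
lemma positive_part_closed:
  fixes K :: "'s::finite \<Rightarrow> 's pmf" and d :: "'s \<Rightarrow> real"
  assumes inv: "\<And>y. d y = (\<Sum>x\<in>UNIV. d x * pmf (K x) y)" and "d x > 0"
  shows "set_pmf (K x) \<subseteq> {y. d y > 0}"
proof -
  let ?A = "{y. d y > 0}"
  let ?k = "\<lambda>x. measure_pmf.prob (K x) ?A"
  have k_sum: "?k z = (\<Sum>y\<in>?A. pmf (K z) y)" for z
    by (rule measure_measure_pmf_finite) simp
  have "(\<Sum>y\<in>?A. d y) = (\<Sum>y\<in>?A. \<Sum>z\<in>UNIV. d z * pmf (K z) y)"
    by (intro sum.cong refl inv)
  also have "\<dots> = (\<Sum>z\<in>UNIV. d z * ?k z)"
    by (subst sum.swap) (simp add: k_sum sum_distrib_left)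
  also have "\<dots> \<le> (\<Sum>z\<in>UNIV. if z \<in> ?A then d z * ?k z else 0)"
    by (intro sum_mono) (auto simp: mult_nonpos_nonneg)
  also have "\<dots> = (\<Sum>z\<in>?A. d z * ?k z)"
    by (subst sum.If_cases) (auto simp: Int_def)
  finally have "(\<Sum>z\<in>?A. d z * (1 - ?k z)) \<le> 0"
    by (simp add: right_diff_distrib sum_subtractf)
  moreover have nonneg: "d z * (1 - ?k z) \<ge> 0" if "z \<in> ?A" for z
    using that by simp
  ultimately have "(\<Sum>z\<in>?A. d z * (1 - ?k z)) = 0"
    by (intro antisym sum_nonneg) auto
  then have "d x * (1 - ?k x) = 0"
    using nonneg assms(2) by (subst (asm) sum_nonneg_eq_0_iff) auto
  then have "?k x = 1" using assms(2) by simp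
  then have "AE y in measure_pmf (K x). y \<in> ?A"
    by (subst (asm) measure_pmf.prob_eq_1) auto
  then show ?thesis by (auto simp: AE_measure_pmf_iff)
qed

text \<open>The difference of two distinct invariant laws has total mass zero, hence both signs occur. Its
  positive and its negative set are disjoint and closed, so recurrent states found in them cannot
  communicate.\<close>
lemma stationary_unique:
  fixes K :: "'s::finite \<Rightarrow> 's pmf"
  assumes single: "\<exists>!C. C \<in> recurrent_classes K"
    and st1: "bind_pmf \<pi>1 K = \<pi>1" and st2: "bind_pmf \<pi>2 K = \<pi>2"
  shows "\<pi>1 = \<pi>2"
proof (rule ccontr)
  assume "\<pi>1 \<noteq> \<pi>2"
  define d where "d x = pmf \<pi>1 x - pmf \<pi>2 x" for x
  have inv: "d y = (\<Sum>x\<in>UNIV. d x * pmf (K x) y)" for y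
    using pmf_bind_finite[of \<pi>1 K y] pmf_bind_finite[of \<pi>2 K y]
    by (simp add: st1 st2 d_def left_diff_distrib sum_subtractf)
  have total: "(\<Sum>x\<in>UNIV. d x) = 0"
    using sum_pmf_eq_1[of UNIV \<pi>1] sum_pmf_eq_1[of UNIV \<pi>2] by (simp add: d_def sum_subtractf)
  obtain x0 where x0: "d x0 \<noteq> 0"
    using \<open>\<pi>1 \<noteq> \<pi>2\<close> by (auto simp: d_def pmf_eq_iff)
  have pos: "\<exists>x. d x > 0"
  proof (rule ccontr)
    assume "\<nexists>x. d x > 0"
    then have "d x \<le> 0" for x by (simp add: not_less)
    then have "(\<Sum>x\<in>UNIV. - d x) > 0"
      using x0 by (intro sum_pos2[of _ x0]) (auto simp: order.strict_iff_order)
    then show False using total by (simp add: sum_negf)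
  qed
  have neg: "\<exists>x. d x < 0"
  proof (rule ccontr)
    assume "\<nexists>x. d x < 0"
    then have "d x \<ge> 0" for x by (simp add: not_less)
    then have "(\<Sum>x\<in>UNIV. d x) > 0"
      using x0 by (intro sum_pos2[of _ x0]) (auto simp: order.strict_iff_order)
    then show False using total by simp
  qed
  have closed_pos: "set_pmf (K x) \<subseteq> {y. d y > 0}" if "x \<in> {y. d y > 0}" for x
    using positive_part_closed[of d K x, OF inv] that by simp
  have inv_neg: "- d y = (\<Sum>x\<in>UNIV. - d x * pmf (K x) y)" for y
    by (subst inv[of y]) (simp add: sum_negf)
  have closed_neg: "set_pmf (K x) \<subseteq> {y. d y < 0}" if "x \<in> {y. d y < 0}" for x
    using positive_part_closed[of "\<lambda>x. - d x" K x, OF inv_neg] that by simp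
  have "{y. d y > 0} \<noteq> {}" using pos by blast
  then obtain a where a: "a \<in> {y. d y > 0}" "recurrent_state K a"
    by (rule closed_set_has_recurrent_state[OF _ closed_pos])
  have "{y. d y < 0} \<noteq> {}" using neg by blast
  then obtain b where b: "b \<in> {y. d y < 0}" "recurrent_state K b"
    by (rule closed_set_has_recurrent_state[OF _ closed_neg])
  have "communicating_class K a = communicating_class K b"
    using single a(2) b(2) by (auto simp: recurrent_classes_def)
  moreover have "b \<in> communicating_class K b"
    by (simp add: communicating_class_def accessible_def)
  ultimately have "accessible K a b" by (auto simp: communicating_class_def)
  then have "b \<in> {y. d y > 0}"
    by (rule accessible_closed[OF _ a(1) closed_pos])
  then show False using b(1) by simp
qed

section \<open>Occupation measures\<close>

text \<open>Only the values of \<open>m x\<close> on \<open>U x\<close> are meaningful, so all conditions, the cost and the support are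
  restricted to admissible pairs.\<close>
definition occupation ::
  "('s::finite \<Rightarrow> 'u set) \<Rightarrow> ('s \<Rightarrow> 'u \<Rightarrow> 's pmf) \<Rightarrow> ('s \<Rightarrow> 'u \<Rightarrow> real) \<Rightarrow> bool" where
  "occupation U P m \<longleftrightarrow>
     (\<forall>x. \<forall>u\<in>U x. 0 \<le> m x u) \<and>
     (\<Sum>x\<in>UNIV. \<Sum>u\<in>U x. m x u) = 1 \<and>
     (\<forall>y. (\<Sum>u\<in>U y. m y u) = (\<Sum>x\<in>UNIV. \<Sum>u\<in>U x. m x u * pmf (P x u) y))"

definition occupation_cost ::
  "('s::finite \<Rightarrow> 'u set) \<Rightarrow> ('s \<Rightarrow> 'u \<Rightarrow> real) \<Rightarrow> ('s \<Rightarrow> 'u \<Rightarrow> real) \<Rightarrow> real" where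
  "occupation_cost U c m = (\<Sum>x\<in>UNIV. \<Sum>u\<in>U x. c x u * m x u)"

definition occupation_support ::
  "('s::finite \<Rightarrow> 'u set) \<Rightarrow> ('s \<Rightarrow> 'u \<Rightarrow> real) \<Rightarrow> ('s \<times> 'u) set" where
  "occupation_support U m = {(x, u). u \<in> U x \<and> m x u \<noteq> 0}"

definition policy_occupation :: "('s \<Rightarrow> 'u) \<Rightarrow> 's pmf \<Rightarrow> 's \<Rightarrow> 'u \<Rightarrow> real" where
  "policy_occupation \<mu> \<pi> x u = (if u = \<mu> x then pmf \<pi> x else 0)"

lemma occupation_nonneg: "occupation U P m \<Longrightarrow> u \<in> U x \<Longrightarrow> 0 \<le> m x u"
  by (simp add: occupation_def)

lemma occupation_total: "occupation U P m \<Longrightarrow> (\<Sum>x\<in>UNIV. \<Sum>u\<in>U x. m x u) = 1"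
  unfolding occupation_def by blast

lemma occupation_balance:
  "occupation U P m \<Longrightarrow>
    (\<Sum>u\<in>U y. m y u) = (\<Sum>x\<in>UNIV. \<Sum>u\<in>U x. m x u * pmf (P x u) y)"
  unfolding occupation_def by blast

lemma sum_policy_occupation:
  assumes "finite (U x)" and "\<mu> x \<in> U x"
  shows "(\<Sum>u\<in>U x. f u * policy_occupation \<mu> \<pi> x u) = f (\<mu> x) * pmf \<pi> x"
proof -
  have "(\<Sum>u\<in>U x. f u * policy_occupation \<mu> \<pi> x u) =
      (\<Sum>u\<in>U x. if u = \<mu> x then f (\<mu> x) * pmf \<pi> x else 0)"
    by (intro sum.cong refl) (simp add: policy_occupation_def)
  then show ?thesis using assms by (simp add: sum.delta)
qed

lemma occupation_policy:
  fixes U :: "'s::finite \<Rightarrow> 'u set"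
  assumes "\<And>x. finite (U x)" and "\<mu> \<in> policies U" and "bind_pmf \<pi> (closed_loop P \<mu>) = \<pi>"
  shows "occupation U P (policy_occupation \<mu> \<pi>)"
    and "(\<Sum>u\<in>U x. policy_occupation \<mu> \<pi> x u) = pmf \<pi> x"
    and "occupation_cost U c (policy_occupation \<mu> \<pi>) = (\<Sum>x\<in>UNIV. pmf \<pi> x * c x (\<mu> x))"
proof -
  have \<mu>: "\<mu> x \<in> U x" for x using assms(2) by (simp add: policies_def)
  note weighted = sum_policy_occupation[where U = U and \<mu> = \<mu>, OF assms(1) \<mu>]
  have marginal: "(\<Sum>u\<in>U x. policy_occupation \<mu> \<pi> x u) = pmf \<pi> x" for x
    using weighted[of "\<lambda>_. 1"] by simp
  have balance: "pmf \<pi> y =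
      (\<Sum>x\<in>UNIV. \<Sum>u\<in>U x. policy_occupation \<mu> \<pi> x u * pmf (P x u) y)" for y
  proof -
    have "pmf \<pi> y = (\<Sum>x\<in>UNIV. pmf \<pi> x * pmf (P x (\<mu> x)) y)"
      using pmf_bind_finite[of \<pi> "closed_loop P \<mu>" y] assms(3) by (simp add: closed_loop_def)
    also have "\<dots> = (\<Sum>x\<in>UNIV. \<Sum>u\<in>U x. policy_occupation \<mu> \<pi> x u * pmf (P x u) y)"
      using weighted[where f = "\<lambda>u. pmf (P _ u) y"] by (simp add: mult.commute)
    finally show ?thesis .
  qed
  have "policy_occupation \<mu> \<pi> x u \<ge> 0" for x u by (simp add: policy_occupation_def)
  moreover have "(\<Sum>x\<in>UNIV. pmf \<pi> x) = 1" by (rule sum_pmf_eq_1) auto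
  ultimately show "occupation U P (policy_occupation \<mu> \<pi>)"
    unfolding occupation_def marginal using balance by blast
  show "(\<Sum>u\<in>U x. policy_occupation \<mu> \<pi> x u) = pmf \<pi> x" by (rule marginal)
  show "occupation_cost U c (policy_occupation \<mu> \<pi>) = (\<Sum>x\<in>UNIV. pmf \<pi> x * c x (\<mu> x))"
    unfolding occupation_cost_def weighted by (simp add: mult.commute)
qed

text \<open>Since \<open>d\<close> has total mass zero and does not vanish, it has a negative entry, so nonnegativity stops
  the motion along \<open>d\<close> at a finite time. The ratio test gives this time \<open>t\<close>. A coordinate of \<open>m\<close> has
  then reached zero, and no new coordinate has become positive because \<open>d\<close> vanishes off the support
  of \<open>m\<close>.\<close>
lemma occupation_move_to_boundary:
  fixes U :: "'s::finite \<Rightarrow> 'u set"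
  assumes fin: "\<And>x. finite (U x)" and occ: "occupation U P m"
    and total: "(\<Sum>x\<in>UNIV. \<Sum>u\<in>U x. d x u) = 0"
    and balance: "\<And>y. (\<Sum>u\<in>U y. d y u) = (\<Sum>x\<in>UNIV. \<Sum>u\<in>U x. d x u * pmf (P x u) y)"
    and supp: "occupation_support U d \<subseteq> occupation_support U m"
    and nonzero: "occupation_support U d \<noteq> {}"
  obtains t where "t > 0" and "occupation U P (\<lambda>x u. m x u + t * d x u)"
    and "occupation_support U (\<lambda>x u. m x u + t * d x u) \<subset> occupation_support U m"
proof -
  have m_nonneg: "m x u \<ge> 0" if "u \<in> U x" for x u
    using occupation_nonneg[OF occ that] .
  define G where "G = {(x, u). u \<in> U x \<and> d x u < 0}"
  have "finite G"
    by (rule finite_subset[of _ "Sigma UNIV U"]) (auto simp: G_def fin)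
  have "G \<noteq> {}"
  proof
    assume "G = {}"
    then have d_nonneg: "d x u \<ge> 0" if "u \<in> U x" for x u
      using that by (force simp: G_def)
    then have "(\<Sum>u\<in>U x. d x u) = 0" for x
      using total by (subst (asm) sum_nonneg_eq_0_iff) (auto intro: sum_nonneg)
    then have "d x u = 0" if "u \<in> U x" for x u
      using d_nonneg that fin by (subst (asm) sum_nonneg_eq_0_iff) auto
    then show False using nonzero by (auto simp: occupation_support_def)
  qed
  define \<tau> where "\<tau> = (\<lambda>(x, u). m x u / - d x u)"
  define t where "t = Min (\<tau> ` G)"
  have "t \<in> \<tau> ` G" unfolding t_def using \<open>finite G\<close> \<open>G \<noteq> {}\<close> by (intro Min_in) auto
  then obtain x1 u1 where z1: "u1 \<in> U x1" "d x1 u1 < 0" "t = m x1 u1 / - d x1 u1"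
    by (auto simp: G_def \<tau>_def)
  have in_supp: "(x1, u1) \<in> occupation_support U m"
    using z1 supp by (auto simp: occupation_support_def)
  then have "m x1 u1 > 0"
    using z1 m_nonneg[of u1 x1] by (auto simp: occupation_support_def less_le)
  then have "t > 0" using z1 by (simp add: divide_pos_neg)
  have t_le: "t \<le> m x u / - d x u" if "u \<in> U x" "d x u < 0" for x u
    unfolding t_def using \<open>finite G\<close> that by (intro Min_le) (force simp: G_def \<tau>_def)+
  have nonneg: "m x u + t * d x u \<ge> 0" if "u \<in> U x" for x u
  proof (cases "d x u < 0")
    case True
    then show ?thesis using t_le[OF that True] by (simp add: field_simps)
  next
    case False
    then show ?thesis using m_nonneg[OF that] \<open>t > 0\<close> by simp
  qed
  have moved_sum: "(\<Sum>x\<in>A. \<Sum>u\<in>U x. (m x u + t * d x u) * w x u) =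
      (\<Sum>x\<in>A. \<Sum>u\<in>U x. m x u * w x u) + t * (\<Sum>x\<in>A. \<Sum>u\<in>U x. d x u * w x u)" for w A
    by (simp add: distrib_right sum.distrib sum_distrib_left mult.assoc)
  have "(\<Sum>x\<in>UNIV. \<Sum>u\<in>U x. m x u + t * d x u) = 1"
    using moved_sum[of "\<lambda>_ _. 1" UNIV] occupation_total[OF occ] total by simp
  moreover have "(\<Sum>u\<in>U y. m y u + t * d y u) =
      (\<Sum>x\<in>UNIV. \<Sum>u\<in>U x. (m x u + t * d x u) * pmf (P x u) y)" for y
    using moved_sum[of "\<lambda>_ _. 1" "{y}"] moved_sum[of "\<lambda>x u. pmf (P x u) y" UNIV]
      occupation_balance[OF occ, of y] balance[of y] by simp
  ultimately have "occupation U P (\<lambda>x u. m x u + t * d x u)"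
    using nonneg unfolding occupation_def by blast
  moreover have "occupation_support U (\<lambda>x u. m x u + t * d x u) \<subset> occupation_support U m"
  proof
    show "occupation_support U (\<lambda>x u. m x u + t * d x u) \<subseteq> occupation_support U m"
      using supp by (auto simp: occupation_support_def)
    have "m x1 u1 + t * d x1 u1 = 0" using z1 by (simp add: field_simps)
    then have "(x1, u1) \<notin> occupation_support U (\<lambda>x u. m x u + t * d x u)"
      by (simp add: occupation_support_def)
    then show "occupation_support U (\<lambda>x u. m x u + t * d x u) \<noteq> occupation_support U m"
      using in_supp by auto
  qed
  ultimately show thesis using that \<open>t > 0\<close> by blast
qed

text \<open>Each of the two directions \<open>m' - m\<close> and \<open>m - m'\<close> reaches the boundary, so the one that does not
  increase the cost can be chosen.\<close>
lemma occupation_shrink_support: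
  fixes U :: "'s::finite \<Rightarrow> 'u set"
  assumes fin: "\<And>x. finite (U x)" and occ: "occupation U P m" and occ': "occupation U P m'"
    and supp: "occupation_support U m' \<subseteq> occupation_support U m"
    and diff: "u \<in> U x" "m' x u \<noteq> m x u"
  obtains k where "occupation U P k" and "occupation_cost U c k \<le> occupation_cost U c m"
    and "occupation_support U k \<subset> occupation_support U m"
proof -
  define \<sigma> :: real where
    "\<sigma> = (if occupation_cost U c m' \<le> occupation_cost U c m then 1 else - 1)"
  define d where "d x u = \<sigma> * (m' x u - m x u)" for x u
  have d_sum: "(\<Sum>x\<in>A. \<Sum>u\<in>U x. d x u * w x u) =
      \<sigma> * ((\<Sum>x\<in>A. \<Sum>u\<in>U x. m' x u * w x u) - (\<Sum>x\<in>A. \<Sum>u\<in>U x. m x u * w x u))" for w A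
    by (simp add: d_def left_diff_distrib right_diff_distrib sum_subtractf sum_distrib_left mult.assoc)
  have total: "(\<Sum>x\<in>UNIV. \<Sum>u\<in>U x. d x u) = 0"
    using d_sum[of "\<lambda>_ _. 1" UNIV] occupation_total[OF occ] occupation_total[OF occ'] by simp
  have balance: "(\<Sum>u\<in>U y. d y u) = (\<Sum>x\<in>UNIV. \<Sum>u\<in>U x. d x u * pmf (P x u) y)" for y
    using d_sum[of "\<lambda>_ _. 1" "{y}"] d_sum[of "\<lambda>x u. pmf (P x u) y" UNIV]
      occupation_balance[OF occ, of y] occupation_balance[OF occ', of y]
    by simp
  have supp_d: "occupation_support U d \<subseteq> occupation_support U m"
    using supp by (auto simp: occupation_support_def d_def)
  have nonzero: "occupation_support U d \<noteq> {}"
    using diff by (auto simp: occupation_support_def d_def \<sigma>_def)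
  obtain t where t: "t > 0" "occupation U P (\<lambda>x u. m x u + t * d x u)"
    "occupation_support U (\<lambda>x u. m x u + t * d x u) \<subset> occupation_support U m"
    using occupation_move_to_boundary[OF fin occ total balance supp_d nonzero] .
  have "occupation_cost U c d = \<sigma> * (occupation_cost U c m' - occupation_cost U c m)"
    using d_sum[of c UNIV] by (simp add: occupation_cost_def mult.commute)
  then have "occupation_cost U c d \<le> 0" by (simp add: \<sigma>_def)
  moreover have "occupation_cost U c (\<lambda>x u. m x u + t * d x u) =
      occupation_cost U c m + t * occupation_cost U c d"
    by (simp add: occupation_cost_def distrib_left sum.distrib sum_distrib_left mult.left_commute)
  ultimately have "occupation_cost U c (\<lambda>x u. m x u + t * d x u) \<le> occupation_cost U c m"
    using t(1) by (simp add: mult_nonneg_nonpos)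
  then show thesis using that t by blast
qed

text \<open>By the balance equation, any state entered from a pair charged by \<open>m\<close> is itself charged. The
  occupied states therefore form a closed set for a policy that uses charged actions there, and this
  set carries a stationary law.\<close>
lemma policy_within_occupation:
  fixes U :: "'s::finite \<Rightarrow> 'u set"
  assumes fin: "\<And>x. finite (U x)" and ne: "\<And>x. U x \<noteq> {}" and occ: "occupation U P m"
  obtains \<mu> \<pi> where "\<mu> \<in> policies U" and "bind_pmf \<pi> (closed_loop P \<mu>) = \<pi>"
    and "occupation_support U (policy_occupation \<mu> \<pi>) \<subseteq> occupation_support U m"
proof -
  have nonneg: "m x u \<ge> 0" if "u \<in> U x" for x u
    using occupation_nonneg[OF occ that] .
  define A where "A = {x. \<exists>u\<in>U x. m x u \<noteq> 0}"
  have "\<exists>u\<in>U x. x \<in> A \<longrightarrow> m x u \<noteq> 0" for x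
    using ne[of x] by (auto simp: A_def)
  then obtain \<mu> where \<mu>: "\<And>x. \<mu> x \<in> U x" "\<And>x. x \<in> A \<Longrightarrow> m x (\<mu> x) \<noteq> 0"
    by metis
  have "A \<noteq> {}"
  proof
    assume "A = {}"
    then have "(\<Sum>x\<in>UNIV. \<Sum>u\<in>U x. m x u) = 0"
      by (intro sum.neutral ballI) (auto simp: A_def)
    then show False using occupation_total[OF occ] by simp
  qed
  then obtain a where a: "a \<in> A" by blast
  have closed: "set_pmf (closed_loop P \<mu> x) \<subseteq> A" if "x \<in> A" for x
  proof
    fix y assume "y \<in> set_pmf (closed_loop P \<mu> x)"
    then have "pmf (P x (\<mu> x)) y > 0" by (simp add: closed_loop_def pmf_positive)
    moreover have "m x (\<mu> x) > 0" using \<mu> that nonneg by (simp add: less_le)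
    ultimately have "0 < m x (\<mu> x) * pmf (P x (\<mu> x)) y" by simp
    also have "\<dots> \<le> (\<Sum>u\<in>U x. m x u * pmf (P x u) y)"
      using \<mu>(1) nonneg by (intro member_le_sum) (auto simp: fin)
    also have "\<dots> \<le> (\<Sum>x\<in>UNIV. \<Sum>u\<in>U x. m x u * pmf (P x u) y)"
      by (rule member_le_sum[where f = "\<lambda>x. \<Sum>u\<in>U x. m x u * pmf (P x u) y"])
        (auto intro!: sum_nonneg simp: nonneg)
    also have "\<dots> = (\<Sum>u\<in>U y. m y u)" using occupation_balance[OF occ] by simp
    finally have "\<exists>u\<in>U y. m y u \<noteq> 0" using sum.neutral[of "U y" "m y"] by fastforce
    then show "y \<in> A" by (simp add: A_def)
  qed
  obtain \<pi> where \<pi>: "bind_pmf \<pi> (closed_loop P \<mu>) = \<pi>" "set_pmf \<pi> \<subseteq> A"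
    by (rule limsup_average_stationary[of A "closed_loop P \<mu>" "return_pmf a", OF closed])
      (use a in auto)
  have "occupation_support U (policy_occupation \<mu> \<pi>) \<subseteq> occupation_support U m"
    using \<mu> \<pi>(2)
    by (auto simp: occupation_support_def policy_occupation_def set_pmf_iff subset_iff
        split: if_splits)
  then show thesis using that[of \<mu> \<pi>] \<mu>(1) \<pi>(1) by (simp add: policies_def)
qed

text \<open>Randomisation does not help: the occupation measure is either already that of the policy found
  inside its support, or it can be replaced by one with a smaller support and no larger cost.\<close>
lemma policy_no_worse_than_occupation:
  fixes U :: "'s::finite \<Rightarrow> 'u set"
  assumes fin: "\<And>x. finite (U x)" and ne: "\<And>x. U x \<noteq> {}" and "occupation U P m"
  shows "\<exists>\<mu> \<pi>. \<mu> \<in> policies U \<and> bind_pmf \<pi> (closed_loop P \<mu>) = \<pi> \<and>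
    (\<Sum>x\<in>UNIV. pmf \<pi> x * c x (\<mu> x)) \<le> occupation_cost U c m"
  using assms(3)
proof (induction "card (occupation_support U m)" arbitrary: m rule: less_induct)
  case less
  obtain \<mu> \<pi> where \<mu>: "\<mu> \<in> policies U" and \<pi>: "bind_pmf \<pi> (closed_loop P \<mu>) = \<pi>"
    and supp: "occupation_support U (policy_occupation \<mu> \<pi>) \<subseteq> occupation_support U m"
    using policy_within_occupation[OF fin ne less.prems] .
  note policy = occupation_policy[OF fin \<mu> \<pi>]
  show ?case
  proof (cases "\<forall>x. \<forall>u\<in>U x. policy_occupation \<mu> \<pi> x u = m x u")
    case True
    then have "occupation_cost U c m = occupation_cost U c (policy_occupation \<mu> \<pi>)"
      by (simp add: occupation_cost_def)
    then show ?thesis using \<mu> \<pi> policy(3) by fastforce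
  next
    case False
    then obtain x u where "u \<in> U x" "policy_occupation \<mu> \<pi> x u \<noteq> m x u" by blast
    then obtain k where k: "occupation U P k" "occupation_cost U c k \<le> occupation_cost U c m"
      "occupation_support U k \<subset> occupation_support U m"
      using occupation_shrink_support[OF fin less.prems policy(1) supp] by metis
    have "finite (occupation_support U m)"
      by (rule finite_subset[of _ "Sigma UNIV U"]) (auto simp: occupation_support_def fin)
    then have "card (occupation_support U k) < card (occupation_support U m)"
      using k(3) by (rule psubset_card_mono)
    then show ?thesis using less.hyps[OF _ k(1)] k(2) by (meson order_trans)
  qed
qed

section \<open>Self-transport and the long-run average\<close>

text \<open>The averaged flow is balanced because the state laws at times \<open>0, \<dots>, N - 1\<close> and those at times
  \<open>1, \<dots>, N\<close> differ only in the endpoint that each omits, and the two endpoint laws coincide.\<close>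
lemma self_transport_average:
  fixes U :: "'s::finite \<Rightarrow> 'u set"
  assumes feas: "self_transport_feasible U P N \<rho> m \<pi>" and "N \<ge> 1"
  shows "occupation U P (\<lambda>x u. 1 / real N * (\<Sum>n<N. m n x u))"
    and "occupation_cost U c (\<lambda>x u. 1 / real N * (\<Sum>n<N. m n x u)) = self_transport_cost U c N m"
proof -
  let ?k = "\<lambda>x u. 1 / real N * (\<Sum>n<N. m n x u)"
  have marginal: "(\<Sum>u\<in>U x. m n x u) = pmf (\<pi> n) x"
    and step: "pmf (\<pi> (Suc n)) y = (\<Sum>x\<in>UNIV. \<Sum>u\<in>U x. m n x u * pmf (P x u) y)"
    and nonneg: "u \<in> U x \<Longrightarrow> 0 \<le> m n x u"
    if "n < N" for n x y u
    using feas that unfolding self_transport_feasible_def by blast+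
  have endpoints: "\<pi> 0 = \<rho>" "\<pi> N = \<rho>"
    using feas unfolding self_transport_feasible_def by blast+
  have swap: "(\<Sum>x\<in>A. \<Sum>u\<in>U x. ?k x u * w x u) =
      1 / real N * (\<Sum>n<N. \<Sum>x\<in>A. \<Sum>u\<in>U x. m n x u * w x u)" for w A
  proof -
    have "(\<Sum>n<N. \<Sum>x\<in>A. \<Sum>u\<in>U x. m n x u * w x u) =
        (\<Sum>x\<in>A. \<Sum>n<N. \<Sum>u\<in>U x. m n x u * w x u)"
      by (rule sum.swap)
    also have "\<dots> = (\<Sum>x\<in>A. \<Sum>u\<in>U x. \<Sum>n<N. m n x u * w x u)"
      by (intro sum.cong refl sum.swap)
    finally show ?thesis by (simp add: sum_distrib_left sum_distrib_right mult.assoc)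
  qed
  have "(\<Sum>u\<in>U y. ?k y u) = 1 / real N * (\<Sum>n<N. pmf (\<pi> n) y)" for y
    using swap[of "\<lambda>_ _. 1" "{y}"] by (simp add: marginal)
  moreover have "(\<Sum>x\<in>UNIV. \<Sum>u\<in>U x. ?k x u * pmf (P x u) y) =
      1 / real N * (\<Sum>n<N. pmf (\<pi> (Suc n)) y)" for y
    unfolding swap by (simp add: step)
  moreover have "(\<Sum>n<N. pmf (\<pi> (Suc n)) y) = (\<Sum>n<N. pmf (\<pi> n) y)" for y
  proof -
    have "(\<Sum>n<N. pmf (\<pi> (Suc n)) y - pmf (\<pi> n) y) = pmf (\<pi> N) y - pmf (\<pi> 0) y"
      by (rule sum_lessThan_telescope)
    also have "\<dots> = 0" using endpoints by simp
    finally show ?thesis by (simp add: sum_subtractf)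
  qed
  ultimately have balance: "(\<Sum>u\<in>U y. ?k y u) = (\<Sum>x\<in>UNIV. \<Sum>u\<in>U x. ?k x u * pmf (P x u) y)"
    for y by simp
  have "(\<Sum>x\<in>UNIV. \<Sum>u\<in>U x. ?k x u) = 1 / real N * (\<Sum>n<N. \<Sum>x\<in>UNIV. pmf (\<pi> n) x)"
    using swap[of "\<lambda>_ _. 1" UNIV] by (simp add: marginal)
  also have "\<dots> = 1" using \<open>N \<ge> 1\<close> by (simp add: sum_pmf_eq_1)
  finally have total: "(\<Sum>x\<in>UNIV. \<Sum>u\<in>U x. ?k x u) = 1" .
  have "?k x u \<ge> 0" if "u \<in> U x" for x u
    using nonneg that by (intro mult_nonneg_nonneg sum_nonneg) auto
  then show "occupation U P ?k"
    unfolding occupation_def using total balance by blast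
  show "occupation_cost U c ?k = self_transport_cost U c N m"
    using swap[of c UNIV] by (simp add: occupation_cost_def self_transport_cost_def mult.commute)
qed

lemma stationary_policy_self_transport:
  fixes U :: "'s::finite \<Rightarrow> 'u set"
  assumes fin: "\<And>x. finite (U x)" and \<mu>: "\<mu> \<in> policies U"
    and \<pi>: "bind_pmf \<pi> (closed_loop P \<mu>) = \<pi>" and "N \<ge> 1"
  shows "g_self_transport U P c N \<pi> \<le> ereal (\<Sum>x\<in>UNIV. pmf \<pi> x * c x (\<mu> x))"
proof -
  note policy = occupation_policy[OF fin \<mu> \<pi>]
  have "self_transport_feasible U P N \<pi> (\<lambda>_. policy_occupation \<mu> \<pi>) (\<lambda>_. \<pi>)"
    using policy(1) unfolding self_transport_feasible_def occupation_def policy(2) by simp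
  moreover have "self_transport_cost U c N (\<lambda>_. policy_occupation \<mu> \<pi>) =
      (\<Sum>x\<in>UNIV. pmf \<pi> x * c x (\<mu> x))"
    using policy(3)[of c] \<open>N \<ge> 1\<close>
    by (simp add: self_transport_cost_def occupation_cost_def)
  ultimately show ?thesis
    unfolding g_self_transport_def by (intro INF_lower2) auto
qed

lemma policy_average_stationary:
  fixes P :: "'s::finite \<Rightarrow> 'u \<Rightarrow> 's pmf"
  obtains \<pi> where "bind_pmf \<pi> (closed_loop P \<mu>) = \<pi>"
    and "limsup (\<lambda>N. ereal (1 / real N * (\<Sum>n<N. expected_cost P c \<pi>0 \<mu> n))) =
         ereal (\<Sum>x\<in>UNIV. pmf \<pi> x * c x (\<mu> x))"
  using limsup_average_stationary[of UNIV "closed_loop P \<mu>" \<pi>0 "\<lambda>x. c x (\<mu> x)"]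
  unfolding expected_cost_marginal by blast

theorem proposition2p1:
  fixes U :: "'s::finite \<Rightarrow> 'u set"
    and P :: "'s \<Rightarrow> 'u \<Rightarrow> 's pmf"
    and c :: "'s \<Rightarrow> 'u \<Rightarrow> real"
    and \<pi>0 :: "'s pmf"
    and N :: nat
  assumes "\<And>x. finite (U x)"
    and "\<And>x. U x \<noteq> {}"
    and single_recurrent_class:
      "\<And>\<mu>. \<mu> \<in> policies U \<Longrightarrow> \<exists>!C. C \<in> recurrent_classes (closed_loop P \<mu>)"
    and "N \<ge> 1"
  shows "(INF \<rho>. g_self_transport U P c N \<rho>) = g_erg U P c \<pi>0"
proof (rule antisym)
  show "(INF \<rho>. g_self_transport U P c N \<rho>) \<le> g_erg U P c \<pi>0"
    unfolding g_erg_def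
  proof (rule INF_greatest)
    fix \<mu> assume \<mu>: "\<mu> \<in> policies U"
    obtain \<pi> where \<pi>: "bind_pmf \<pi> (closed_loop P \<mu>) = \<pi>"
      "limsup (\<lambda>N. ereal (1 / real N * (\<Sum>n<N. expected_cost P c \<pi>0 \<mu> n))) =
         ereal (\<Sum>x\<in>UNIV. pmf \<pi> x * c x (\<mu> x))"
      using policy_average_stationary .
    have "(INF \<rho>. g_self_transport U P c N \<rho>) \<le> g_self_transport U P c N \<pi>"
      by (rule INF_lower) simp
    also have "\<dots> \<le> ereal (\<Sum>x\<in>UNIV. pmf \<pi> x * c x (\<mu> x))"
      by (rule stationary_policy_self_transport[OF assms(1) \<mu> \<pi>(1) assms(4)])
    finally show "(INF \<rho>. g_self_transport U P c N \<rho>) \<le>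
        limsup (\<lambda>N. ereal (1 / real N * (\<Sum>n<N. expected_cost P c \<pi>0 \<mu> n)))"
      unfolding \<pi>(2) .
  qed
next
  have "g_erg U P c \<pi>0 \<le> ereal (self_transport_cost U c N m)"
    if feas: "self_transport_feasible U P N \<rho> m \<pi>" for \<rho> m \<pi>
  proof -
    note average = self_transport_average[OF feas assms(4)]
    obtain \<mu> \<pi>' where \<mu>: "\<mu> \<in> policies U" and \<pi>': "bind_pmf \<pi>' (closed_loop P \<mu>) = \<pi>'"
      and cost: "(\<Sum>x\<in>UNIV. pmf \<pi>' x * c x (\<mu> x)) \<le> self_transport_cost U c N m"
      using policy_no_worse_than_occupation[OF assms(1,2) average(1), of c]
      unfolding average(2) by blast
    obtain \<pi>'' where \<pi>'': "bind_pmf \<pi>'' (closed_loop P \<mu>) = \<pi>''"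
      "limsup (\<lambda>N. ereal (1 / real N * (\<Sum>n<N. expected_cost P c \<pi>0 \<mu> n))) =
         ereal (\<Sum>x\<in>UNIV. pmf \<pi>'' x * c x (\<mu> x))"
      using policy_average_stationary .
    \<comment> \<open>\<open>\<pi>'\<close> attains the cost bound and \<open>\<pi>''\<close> the average from \<open>\<pi>0\<close>; only uniqueness identifies them.\<close>
    have "\<pi>'' = \<pi>'"
      by (rule stationary_unique[OF single_recurrent_class[OF \<mu>] \<pi>''(1) \<pi>'])
    have "g_erg U P c \<pi>0 \<le>
        limsup (\<lambda>N. ereal (1 / real N * (\<Sum>n<N. expected_cost P c \<pi>0 \<mu> n)))"
      unfolding g_erg_def using \<mu> by (rule INF_lower)
    then show ?thesis
      unfolding \<pi>''(2) \<open>\<pi>'' = \<pi>'\<close> using cost by (meson ereal_less_eq(3) order_trans)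
  qed
  then show "g_erg U P c \<pi>0 \<le> (INF \<rho>. g_self_transport U P c N \<rho>)"
    unfolding g_self_transport_def by (intro INF_greatest) auto
qed

end
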